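(* The Clebsch graph (the 5-regular graph on 16 vertices and 40 edges, also known as the Greenwood–Gleason graph) is not word-representable.
   Context: Graphs are finite, simple and undirected. Two distinct letters $x$ and $y$ alternate in a word $w$ if after deleting from $w$ all letters except the copies of $x$ and $y$ one obtains either a word $xyxy\cdots$ (of even or odd length) or a word $yxyx\cdots$ (of even or odd length). A graph $G=(V,E)$ is word-representable if there exists a (finite) word $w$ over the alphabet $V$, in which each letter of $V$ occurs at least once, such that for all distinct $x,y\in V$, the letters $x$ and $y$ alternate in $w$ if and only if $xy\in E$. The Clebsch graph is the graph with vertex set $\{1,2,\ldots,16\}$ and the following 40 edges (written $a$-$b$): 1-4, 3-6, 5-8, 7-10, 9-12, 11-14, 13-16, 2-15; 2-3, 4-5, 6-7, 8-9, 10-11, 12-13, 14-15, 1-16; 2-4, 4-6, 6-8, 8-10, 10-12, 12-14, 14-16, 2-16; 2-10, 4-12, 6-14, 8-16, 1-9, 3-11, 5-13, 7-15; 1-7, 3-9, 5-11, 7-13, 9-15, 1-11, 3-13, 5-15. *)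

theory Defs
  imports Main
begin

(* A graph is given by its vertex set V and its set E of edges, each edge being the
   two-element set of its ends. *)

definition simple_graph :: "'a set \<Rightarrow> 'a set set \<Rightarrow> bool" where
  "simple_graph V E \<longleftrightarrow> finite V \<and> (\<forall>e\<in>E. e \<subseteq> V \<and> card e = 2)"

(* The word x y x y ... of length n, for n of either parity. *)
definition alt_word :: "'a \<Rightarrow> 'a \<Rightarrow> nat \<Rightarrow> 'a list" where
  "alt_word x y n = map (\<lambda>i. if even i then x else y) [0..<n]"

definition alternate :: "'a \<Rightarrow> 'a \<Rightarrow> 'a list \<Rightarrow> bool" where
  "alternate x y w \<longleftrightarrow>
     (\<exists>n. filter (\<lambda>z. z = x \<or> z = y) w = alt_word x y n \<or>
          filter (\<lambda>z. z = x \<or> z = y) w = alt_word y x n)"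

(* The condition "set w = V" says both that w is a word over the alphabet V and that
   every letter of V occurs in it. *)
definition word_representable :: "'a set \<Rightarrow> 'a set set \<Rightarrow> bool" where
  "word_representable V E \<longleftrightarrow>
     (\<exists>w. set w = V \<and>
          (\<forall>x\<in>V. \<forall>y\<in>V. x \<noteq> y \<longrightarrow> (alternate x y w \<longleftrightarrow> {x, y} \<in> E)))"

definition clebsch_verts :: "nat set" where
  "clebsch_verts = {1..16}"

definition clebsch_edges :: "nat set set" where
  "clebsch_edges =
    {{1,4}, {3,6}, {5,8}, {7,10}, {9,12}, {11,14}, {13,16}, {2,15},
     {2,3}, {4,5}, {6,7}, {8,9}, {10,11}, {12,13}, {14,15}, {1,16},
     {2,4}, {4,6}, {6,8}, {8,10}, {10,12}, {12,14}, {14,16}, {2,16},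
     {2,10}, {4,12}, {6,14}, {8,16}, {1,9}, {3,11}, {5,13}, {7,15},
     {1,7}, {3,9}, {5,11}, {7,13}, {9,15}, {1,11}, {3,13}, {5,15}}"

lemma simple_graph_clebsch: "simple_graph clebsch_verts clebsch_edges"
  by (simp add: simple_graph_def clebsch_verts_def clebsch_edges_def)

lemma card_clebsch_verts: "card clebsch_verts = 16"
  by (simp add: clebsch_verts_def)

lemma card_clebsch_edges: "card clebsch_edges = 40"
  by (simp add: clebsch_edges_def doubleton_eq_iff)

lemma clebsch_5_regular:
  assumes "v \<in> clebsch_verts"
  shows "card {e \<in> clebsch_edges. v \<in> e} = 5"
proof -
  have "[1..<17] = [1,2,3,4,5,6,7,8,9,10,11,12,13,14,15,16::nat]"
    by (simp add: upt_rec)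
  moreover have "v \<in> set [1..<17]"
    using assms by (simp add: clebsch_verts_def)
  ultimately have "v \<in> set [1,2,3,4,5,6,7,8,9,10,11,12,13,14,15,16]"
    by (simp only:)
  then have "v \<in> {1,2,3,4,5,6,7,8,9,10,11,12,13,14,15,16}"
    by (simp only: list.set)
  then have "card (clebsch_edges \<inter> {e. v \<in> e}) = 5"
    unfolding clebsch_edges_def by (elim insertE emptyE) (simp_all add: doubleton_eq_iff)
  then show ?thesis
    by (simp add: Int_def)
qed

end

theory Submission
  imports Defs
begin

text \<open>
  Orient each edge \<open>xy\<close> of a represented graph from the letter that comes first in the word to
  the other one. In a 4-cycle without chords, exactly two of the four edges then point each way
  round, so the signed sum of the orientation around the 4-cycle is 0. The Clebsch graph is the
  5-cube with antipodal points identified; a 5-cycle that uses all five directions, traversed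
  twice, bounds ten 4-cycles of the cube (a rhombic tiling of a decagon). Hence the signed sum
  around this 5-cycle is 0, although it is a sum of five odd numbers.
\<close>

text \<open>Counting in prefixes lets facts about several letters follow by chaining inequalities.
  If neither letter occurs, the relation holds in both directions.\<close>

definition leads :: "'a list \<Rightarrow> 'a \<Rightarrow> 'a \<Rightarrow> bool" where
  "leads w x y \<longleftrightarrow> (\<forall>k. count_list (take k w) y \<le> count_list (take k w) x \<and>
                        count_list (take k w) x \<le> Suc (count_list (take k w) y))"

lemma all_nat_iff: "(\<forall>k. P k) \<longleftrightarrow> P 0 \<and> (\<forall>k. P (Suc k))"
  by (metis not0_implies_Suc)

lemma ex_nat_iff: "(\<exists>k. P k) \<longleftrightarrow> P 0 \<or> (\<exists>k. P (Suc k))"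
  by (metis not0_implies_Suc)

lemma leads_Nil: "leads [] x y"
  by (simp add: leads_def)

text \<open>With a leading \<open>x\<close> stripped, the bounds y \<le> x + 1 \<le> y + 1 on the
  counts become x \<le> y \<le> x + 1, so the roles swap. A leading \<open>y\<close> already breaks
  the bounds in the prefix of length 1.\<close>

lemma leads_Cons:
  assumes "x \<noteq> y"
  shows "leads (z # w) x y \<longleftrightarrow> (if z = x then leads w y x else z \<noteq> y \<and> leads w x y)"
proof (cases "z = y")
  case True
  have "\<not> leads (y # w) x y"
    unfolding leads_def using assms by (auto intro!: exI[of _ "Suc 0"])
  then show ?thesis using True assms by auto
next
  case False
  then show ?thesis
    unfolding leads_def using assms
    by (subst all_nat_iff) auto
qed

lemma alt_word_0: "alt_word x y 0 = []"
  by (simp add: alt_word_def)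

lemma alt_word_Suc: "alt_word x y (Suc n) = x # alt_word y x n"
  by (simp add: alt_word_def upt_conv_Cons flip: map_Suc_upt del: upt_Suc)

lemma ex_filter_eq_alt_word_iff_leads:
  assumes "x \<noteq> y"
  shows "(\<exists>n. filter (\<lambda>z. z = x \<or> z = y) w = alt_word x y n) \<longleftrightarrow> leads w x y"
  using assms
\<comment> \<open>Past a leading \<open>x\<close> the hypothesis is needed with the two letters
  swapped.\<close>
proof (induction w arbitrary: x y)
  case Nil
  show ?case by (auto simp: leads_Nil intro!: exI[of _ 0] alt_word_0[symmetric])
next
  case (Cons z w)
  have flip: "filter (\<lambda>z. z = x \<or> z = y) w = filter (\<lambda>z. z = y \<or> z = x) w"
    by (rule filter_cong) auto
  consider "z = x" | "z = y" | "z \<noteq> x" "z \<noteq> y" by blast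
  then show ?case
  proof cases
    case 1
    have "(\<exists>n. filter (\<lambda>z. z = x \<or> z = y) (z # w) = alt_word x y n) \<longleftrightarrow>
          (\<exists>n. filter (\<lambda>z. z = y \<or> z = x) w = alt_word y x n)"
      using 1 flip by (subst ex_nat_iff) (auto simp: alt_word_0 alt_word_Suc)
    then show ?thesis
      using 1 Cons.IH[of y x] Cons.prems by (simp add: leads_Cons)
  next
    case 2
    have "alt_word x y n \<noteq> y # u" for n u
      using Cons.prems by (cases n) (auto simp: alt_word_0 alt_word_Suc)
    then show ?thesis
      using 2 Cons.prems by (simp add: leads_Cons) metis
  next
    case 3
    then show ?thesis
      using Cons.IH[of x y] Cons.prems by (simp add: leads_Cons)
  qed
qed

lemma alternate_iff_leads:
  assumes "x \<noteq> y"
  shows "alternate x y w \<longleftrightarrow> leads w x y \<or> leads w y x"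
proof -
  have flip: "filter (\<lambda>z. z = x \<or> z = y) w = filter (\<lambda>z. z = y \<or> z = x) w"
    by (rule filter_cong) auto
  have "alternate x y w \<longleftrightarrow>
          (\<exists>n. filter (\<lambda>z. z = x \<or> z = y) w = alt_word x y n) \<or>
          (\<exists>n. filter (\<lambda>z. z = y \<or> z = x) w = alt_word y x n)"
    unfolding alternate_def ex_disj_distrib flip ..
  then show ?thesis
    using ex_filter_eq_alt_word_iff_leads[of x y w] ex_filter_eq_alt_word_iff_leads[of y x w] assms
    by simp
qed

text \<open>Both directions together force equal counts in every prefix, but reading an occurrence
  of \<open>x\<close> raises only one of the two counts.\<close>

lemma leads_antisym:
  assumes "leads w x y" "leads w y x" "x \<in> set w"
  shows "x = y"
proof (rule ccontr)
  assume "x \<noteq> y"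
  obtain u v where w: "w = u @ x # v"
    using assms(3) by (meson split_list)
  have eq: "count_list (take k w) x = count_list (take k w) y" for k
    using assms(1,2) unfolding leads_def by (meson le_antisym)
  show False
    using eq[of "length u"] eq[of "Suc (length u)"] \<open>x \<noteq> y\<close>
    by (simp add: w)
qed

text \<open>In every prefix the counts satisfy c \<le> b \<le> a and a \<le> d + 1 \<le> c +
  1.\<close>

lemma leads_shortcut:
  assumes "leads w a b" "leads w b c" "leads w c d" "leads w a d"
  shows "leads w a c"
  using assms unfolding leads_def by (meson Suc_le_mono order_trans)

text \<open>Counts cannot increase along the directed cycle, so all four agree in every
  prefix.\<close>

lemma leads_cycle4:
  assumes "leads w a b" "leads w b c" "leads w c d" "leads w d a"
  shows "leads w a c"
  using assms unfolding leads_def by (meson le_SucI order_trans)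

text \<open>For distinct letters that do not alternate the value is -1 both ways; only on edges is
  it an orientation.\<close>

definition arc_sign :: "'a list \<Rightarrow> 'a \<Rightarrow> 'a \<Rightarrow> int" where
  "arc_sign w x y = (if leads w x y then 1 else -1)"

lemma odd_arc_sign: "odd (arc_sign w x y)"
  by (simp add: arc_sign_def)

lemma arc_sign_swap:
  assumes "x \<noteq> y" "x \<in> set w" "alternate x y w"
  shows "arc_sign w y x = - arc_sign w x y"
  using assms leads_antisym[of w x y] alternate_iff_leads[of x y w] by (auto simp: arc_sign_def)

lemma arc_sign_induced_cycle4:
  assumes "distinct [a, b, c, d]"
    and "alternate a b w" "alternate b c w" "alternate c d w" "alternate d a w"
    and "\<not> alternate a c w" "\<not> alternate b d w"
  shows "arc_sign w a b + arc_sign w b c + arc_sign w c d + arc_sign w d a = 0"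
proof -
  have edge: "leads w a b \<or> leads w b a" "leads w b c \<or> leads w c b"
      "leads w c d \<or> leads w d c" "leads w d a \<or> leads w a d"
    using assms by (auto simp: alternate_iff_leads)
  have chord: "\<not> leads w a c" "\<not> leads w c a" "\<not> leads w b d" "\<not> leads w d b"
    using assms by (auto simp: alternate_iff_leads)
  \<comment> \<open>Three consecutive edges pointing the same way round would make the ends of a
    chord alternate: by \<open>leads_shortcut\<close> or \<open>leads_cycle4\<close>, depending on
    the direction of the fourth edge. Hence neither sign occurs three times.\<close>
  have "\<not> (leads w a b \<and> leads w b c \<and> leads w c d)" "\<not> (leads w b c \<and> leads w c d \<and> leads w d a)"
      "\<not> (leads w c d \<and> leads w d a \<and> leads w a b)" "\<not> (leads w d a \<and> leads w a b \<and> leads w b c)"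
      "\<not> (leads w b a \<and> leads w c b \<and> leads w d c)" "\<not> (leads w c b \<and> leads w d c \<and> leads w a d)"
      "\<not> (leads w d c \<and> leads w a d \<and> leads w b a)" "\<not> (leads w a d \<and> leads w b a \<and> leads w c b)"
    using edge chord leads_shortcut[of w] leads_cycle4[of w] by meson+
  then show ?thesis
    using edge by (auto simp: arc_sign_def)
qed

theorem mainTheorem3:
  shows "\<not> word_representable clebsch_verts clebsch_edges"
proof
  assume "word_representable clebsch_verts clebsch_edges"
  then obtain w where set_w: "set w = clebsch_verts"
    and rep: "\<And>x y. x \<in> clebsch_verts \<Longrightarrow> y \<in> clebsch_verts \<Longrightarrow> x \<noteq> y \<Longrightarrow>
                alternate x y w \<longleftrightarrow> {x, y} \<in> clebsch_edges"
    unfolding word_representable_def by blast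
  define s where "s = arc_sign w"
  have swap: "s y x = - s x y"
    if "{x, y} \<in> clebsch_edges" "x \<noteq> y" "x \<in> clebsch_verts" "y \<in> clebsch_verts" for x y
    unfolding s_def using that by (intro arc_sign_swap) (simp_all add: set_w rep)
  have square: "s a b + s b c + s c d + s d a = 0"
    if "set [a, b, c, d] \<subseteq> clebsch_verts" "distinct [a, b, c, d]"
      "{{a, b}, {b, c}, {c, d}, {d, a}} \<subseteq> clebsch_edges"
      "{a, c} \<notin> clebsch_edges" "{b, d} \<notin> clebsch_edges" for a b c d
    unfolding s_def using that by (intro arc_sign_induced_cycle4) (simp_all add: rep)
  note graph = clebsch_verts_def clebsch_edges_def doubleton_eq_iff
  \<comment> \<open>The ten tiles of the decagon, all traversed in the same sense; its boundary is
    the 5-cycle 1-4-6-14-16 run twice.\<close>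
  have
    "s 1 4 + s 4 6 + s 6 7 + s 7 1 = 0"
    "s 7 6 + s 6 14 + s 14 15 + s 15 7 = 0"
    "s 15 14 + s 14 16 + s 16 2 + s 2 15 = 0"
    "s 2 16 + s 16 1 + s 1 4 + s 4 2 = 0"
    "s 1 7 + s 7 15 + s 15 9 + s 9 1 = 0"
    "s 9 15 + s 15 2 + s 2 3 + s 3 9 = 0"
    "s 3 2 + s 2 4 + s 4 6 + s 6 3 = 0"
    "s 1 9 + s 9 3 + s 3 11 + s 11 1 = 0"
    "s 11 3 + s 3 6 + s 6 14 + s 14 11 = 0"
    "s 1 11 + s 11 14 + s 14 16 + s 16 1 = 0"
    by (rule square; simp add: graph)+
  \<comment> \<open>The 15 inner edges of the tiling: each lies on two tiles, which traverse it in
    opposite directions, so it cancels.\<close>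
  moreover have
    "s 7 1 = - s 1 7" "s 7 6 = - s 6 7" "s 15 7 = - s 7 15" "s 15 14 = - s 14 15"
    "s 2 15 = - s 15 2" "s 2 16 = - s 16 2" "s 4 2 = - s 2 4" "s 9 1 = - s 1 9"
    "s 9 15 = - s 15 9" "s 3 9 = - s 9 3" "s 3 2 = - s 2 3" "s 6 3 = - s 3 6"
    "s 11 1 = - s 1 11" "s 11 3 = - s 3 11" "s 14 11 = - s 11 14"
    by (rule swap; simp add: graph)+
  \<comment> \<open>Adding the ten equations leaves twice this sum.\<close>
  ultimately have "s 1 4 + s 4 6 + s 6 14 + s 14 16 + s 16 1 = 0"
    by linarith
  moreover have "odd (s 1 4 + s 4 6 + s 6 14 + s 14 16 + s 16 1)"
    by (simp add: s_def odd_arc_sign)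
  ultimately show False by simp
qed

end
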